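(* Let $\lambda\in\mathbb{C}_p$ with $\lambda\ne0$ and $|\lambda|_p\le1$ ($p$ an odd prime). For every $n\ge0$, \[ Ch_{n,\lambda}(x)=\sum_{k=0}^n\sum_{m=0}^k\binom{n}{k}(x)_{m,\lambda}\,S_1(k,m)\,Ch_{n-k,\lambda}. \]
   Context: $(x)_{0,\lambda}=1$, $(x)_{n,\lambda}=x(x-\lambda)\cdots(x-(n-1)\lambda)$ for $n\ge1$, and $(1+\lambda u)^{x/\lambda}=\sum_{m\ge0}(x)_{m,\lambda}u^m/m!$. $S_1(k,m)$ are the signed Stirling numbers of the first kind: $x(x-1)\cdots(x-k+1)=\sum_{m=0}^kS_1(k,m)x^m$. The degenerate Changhee polynomials of the second kind are defined by $\frac{2}{1+(1+\lambda\log(1+t))^{1/\lambda}}(1+\lambda\log(1+t))^{x/\lambda}=\sum_{n\ge0}Ch_{n,\lambda}(x)\frac{t^n}{n!}$, and $Ch_{n,\lambda}=Ch_{n,\lambda}(0)$ are the degenerate Changhee numbers of the second kind. *)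

theory Defs
  imports "HOL-Analysis.Analysis" "HOL-Computational_Algebra.Computational_Algebra"
begin

text \<open>The \<open>p\<close>-adic absolute value on the rationals, normalised by \<open>\<bar>p\<bar> = 1/p\<close>.\<close>

definition padic_abs :: "nat \<Rightarrow> rat \<Rightarrow> real" where
  "padic_abs p q = (if q = 0 then 0 else
     real p powi (int (multiplicity (int p) (snd (quotient_of q)))
                - int (multiplicity (int p) (fst (quotient_of q)))))"

text \<open>
  The field of \<open>p\<close>-adic complex numbers is the completion of an algebraic closure of \<open>\<rat>\<^sub>p\<close>,
  where \<open>\<rat>\<^sub>p\<close> is the completion of \<open>\<rat>\<close> at \<open>p\<close>.  There is no such type in the library, so
  it is described up to isometric isomorphism: a complete field with an absolute value extending
  the \<open>p\<close>-adic one.  Inside a complete field, the completion of a subfield is its topological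
  closure; so \<open>\<rat>\<^sub>p\<close> is the closure of \<open>\<rat>\<close>, and the elements algebraic over \<open>\<rat>\<^sub>p\<close> have to form
  an algebraically closed field (that is, an algebraic closure of \<open>\<rat>\<^sub>p\<close>) which is dense.
\<close>

definition abs_dist :: "('a::ab_group_add \<Rightarrow> real) \<Rightarrow> 'a \<Rightarrow> 'a \<Rightarrow> real" where
  "abs_dist nrm x y = nrm (x - y)"

definition abs_closure :: "('a::ab_group_add \<Rightarrow> real) \<Rightarrow> 'a set \<Rightarrow> 'a set" where
  "abs_closure nrm S = Metric_space.mtopology UNIV (abs_dist nrm) closure_of S"

definition padic_numbers :: "('a::field_char_0 \<Rightarrow> real) \<Rightarrow> 'a set" where
  "padic_numbers nrm = abs_closure nrm \<rat>"

definition padic_algebraic :: "('a::field_char_0 \<Rightarrow> real) \<Rightarrow> 'a set" where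
  "padic_algebraic nrm =
     {x. \<exists>f. f \<noteq> 0 \<and> (\<forall>i. coeff f i \<in> padic_numbers nrm) \<and> poly f x = 0}"

locale padic_complex_field =
  fixes p :: nat and nrm :: "'a::field_char_0 \<Rightarrow> real"
  assumes prime: "prime p"
    and nrm_nonneg: "0 \<le> nrm x"
    and nrm_eq_0_iff: "nrm x = 0 \<longleftrightarrow> x = 0"
    and nrm_mult: "nrm (x * y) = nrm x * nrm y"
    and nrm_ultrametric: "nrm (x + y) \<le> max (nrm x) (nrm y)"
    and nrm_of_rat: "nrm (of_rat q) = padic_abs p q"
    and complete: "Metric_space.mcomplete UNIV (abs_dist nrm)"
    and padic_algebraic_closed:
      "degree f > 0 \<Longrightarrow> (\<And>i. coeff f i \<in> padic_algebraic nrm)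
         \<Longrightarrow> \<exists>x\<in>padic_algebraic nrm. poly f x = 0"
    and padic_algebraic_dense: "abs_closure nrm (padic_algebraic nrm) = UNIV"

definition degenerate_ffact :: "'a::comm_ring_1 \<Rightarrow> nat \<Rightarrow> 'a \<Rightarrow> 'a" where
  "degenerate_ffact lam n x = (\<Prod>i<n. x - of_nat i * lam)"

text \<open>The formal power series \<open>(1 + lam u) ^ (x / lam)\<close> in \<open>u\<close>.\<close>

definition degenerate_exp :: "'a::field_char_0 \<Rightarrow> 'a \<Rightarrow> 'a fps" where
  "degenerate_exp lam x = Abs_fps (\<lambda>m. degenerate_ffact lam m x / fact m)"

definition signed_stirling :: "nat \<Rightarrow> nat \<Rightarrow> int" where
  "signed_stirling k m = coeff (\<Prod>i<k. [:- int i, 1:]) m"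

text \<open>
  The generating function of the degenerate Changhee polynomials of the second kind, as a formal
  power series in \<open>t\<close>; \<open>fps_ln 1\<close> is the series \<open>log (1 + t)\<close>.
\<close>

definition degenerate_Changhee_gf :: "'a::field_char_0 \<Rightarrow> 'a \<Rightarrow> 'a fps" where
  "degenerate_Changhee_gf lam x =
     2 / (1 + (degenerate_exp lam 1 oo fps_ln 1)) * (degenerate_exp lam x oo fps_ln 1)"

definition degenerate_Changhee_poly :: "'a::field_char_0 \<Rightarrow> nat \<Rightarrow> 'a \<Rightarrow> 'a" where
  "degenerate_Changhee_poly lam n x = fact n * fps_nth (degenerate_Changhee_gf lam x) n"

definition degenerate_Changhee_number :: "'a::field_char_0 \<Rightarrow> nat \<Rightarrow> 'a" where
  "degenerate_Changhee_number lam n = degenerate_Changhee_poly lam n 0"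

end

theory Submission
  imports Defs
begin

text \<open>The generating function of the polynomials is that of the numbers times
  \<open>degenerate_exp lam x oo fps_ln 1\<close>, and the powers of \<open>log (1 + t)\<close> generate the Stirling
  numbers of the first kind: \<open>log (1 + t) ^ m = m! (\<Sum>k. S\<^sub>1(k, m) t ^ k / k!)\<close>. The claim follows
  by comparing coefficients.\<close>

lemma signed_stirling_0: "signed_stirling 0 m = (if m = 0 then 1 else 0)"
  by (simp add: signed_stirling_def)

lemma signed_stirling_Suc_0: "signed_stirling (Suc k) 0 = - int k * signed_stirling k 0"
  by (simp add: signed_stirling_def coeff_mult)

text \<open>Multiplying by the last factor \<open>[:- int k, 1:]\<close> shifts the coefficients up
  by one and subtracts \<open>int k\<close> times the old ones.\<close>

lemma signed_stirling_Suc_Suc: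
  "signed_stirling (Suc k) (Suc m) = signed_stirling k m - int k * signed_stirling k (Suc m)"
proof -
  have "(\<Prod>i<Suc k. [:- int i, 1:])
      = pCons 0 (\<Prod>i<k. [:- int i, 1:]) - smult (int k) (\<Prod>i<k. [:- int i, 1:])"
    by (simp add: mult.commute[of _ "[:_, _:]"])
  then show ?thesis
    by (simp add: signed_stirling_def del: prod.lessThan_Suc)
qed

text \<open>Coefficientwise form of \<open>(1 + t) (L ^ (m + 1))' = (m + 1) L ^ m\<close> for \<open>L = log (1 + t)\<close>.\<close>

lemma fps_ln_power_nth_recurrence:
  fixes k m :: nat
  defines "L \<equiv> fps_ln (1::'a::field_char_0)"
  shows "of_nat (Suc k) * (L ^ Suc m) $ Suc k
    = of_nat (Suc m) * (L ^ m) $ k - of_nat k * (L ^ Suc m) $ k"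
proof -
  have "fps_deriv (L ^ Suc m) = of_nat (Suc m) * (fps_deriv L * L ^ m)"
    by (simp add: fps_deriv_power fps_of_nat mult_ac del: of_nat_Suc power_Suc)
  then have "(1 + fps_X) * fps_deriv (L ^ Suc m)
      = of_nat (Suc m) * ((1 + fps_X) * fps_deriv L) * L ^ m"
    by (simp add: mult_ac)
  also have "(1 + fps_X) * fps_deriv L = 1"
    by (simp add: L_def fps_ln_deriv inverse_mult_eq_1')
  finally have "((1 + fps_X) * fps_deriv (L ^ Suc m)) $ k = (of_nat (Suc m) * L ^ m) $ k"
    by simp
  moreover have "((1 + fps_X) * fps_deriv (L ^ Suc m)) $ k
      = of_nat (Suc k) * (L ^ Suc m) $ Suc k + of_nat k * (L ^ Suc m) $ k"
    \<comment> \<open>The \<open>fps_X\<close> part contributes the derivative's coefficient at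
      \<open>k - 1\<close>; for \<open>k = 0\<close> there is none, which matches the factor
      \<open>of_nat k\<close>.\<close>
    by (cases k) (simp_all add: distrib_right del: of_nat_Suc power_Suc)
  moreover have "(of_nat (Suc m) * L ^ m) $ k = of_nat (Suc m) * (L ^ m) $ k"
    by (simp add: fps_of_nat[symmetric] del: of_nat_Suc)
  ultimately show ?thesis
    by (simp add: eq_diff_eq)
qed

text \<open>Up to the factor \<open>fact m / fact k\<close>, both sides obey the same recurrence in
  \<open>k\<close>. It relates \<open>m\<close> to \<open>m - 1\<close>, hence the induction with
  \<open>m\<close> arbitrary.\<close>

lemma fps_ln_power_nth:
  "(fps_ln (1::'a::field_char_0) ^ m) $ k = fact m * of_int (signed_stirling k m) / fact k"
proof (induction k arbitrary: m)
  case 0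
  then show ?case
    by (cases m) (simp_all add: signed_stirling_0 fps_ln_def)
next
  case (Suc k)
  show ?case
  proof (cases m)
    case 0
    \<comment> \<open>The recurrence does not reach \<open>m = 0\<close>. There the power is 1, so
      the Stirling number vanishes for \<open>k > 0\<close>, and the factor \<open>of_nat k\<close>
      covers \<open>k = 0\<close>.\<close>
    have "of_nat k * of_int (signed_stirling k 0) = (0::'a)"
      using Suc.IH[of 0] by (cases k) (simp_all del: of_nat_Suc)
    with 0 show ?thesis
      by (simp add: signed_stirling_Suc_0)
  next
    case (Suc j)
    define a where "a = (fps_ln (1::'a) ^ Suc j) $ Suc k"
    have "of_nat (Suc k) * a = of_nat (Suc j) * (fact j * of_int (signed_stirling k j) / fact k)
        - of_nat k * (fact (Suc j) * of_int (signed_stirling k (Suc j)) / fact k)"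
      unfolding a_def fps_ln_power_nth_recurrence Suc.IH ..
    also have "\<dots> = fact (Suc j) * of_int (signed_stirling (Suc k) (Suc j)) / fact k"
      by (simp add: signed_stirling_Suc_Suc diff_divide_distrib right_diff_distrib mult_ac
          del: of_nat_Suc)
    finally have "a = fact (Suc j) * of_int (signed_stirling (Suc k) (Suc j)) / fact (Suc k)"
      by (simp add: eq_divide_eq mult_ac del: of_nat_Suc)
    then show ?thesis
      unfolding a_def Suc .
  qed
qed

text \<open>The \<open>fact m\<close> from the \<open>m\<close>-th power of the logarithm cancels
  the denominator in \<open>degenerate_exp\<close>.\<close>

lemma degenerate_exp_compose_ln_nth:
  "(degenerate_exp lam x oo fps_ln 1) $ k
    = (\<Sum>m=0..k. degenerate_ffact lam m x * of_int (signed_stirling k m)) / fact k"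
  unfolding fps_compose_nth fps_ln_power_nth degenerate_exp_def
  by (simp add: sum_divide_distrib)

lemma degenerate_exp_0: "degenerate_exp lam 0 = 1"
proof -
  have "degenerate_ffact lam m 0 = (if m = 0 then 1 else 0)" for m
    by (auto simp: degenerate_ffact_def)
  then show ?thesis
    by (simp add: degenerate_exp_def fps_eq_iff)
qed

text \<open>At \<open>x = 0\<close> the second factor of the generating function is 1, which leaves
  only the quotient.\<close>

lemma degenerate_Changhee_gf_eq:
  "degenerate_Changhee_gf lam x
    = (degenerate_exp lam x oo fps_ln 1) * degenerate_Changhee_gf lam 0"
  by (simp add: degenerate_Changhee_gf_def degenerate_exp_0 mult.commute)

theorem theorem2p4:
  fixes p :: nat and nrm :: "'a::field_char_0 \<Rightarrow> real" and lam x :: 'a and n :: nat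
  assumes "prime p" and "odd p"
    and "padic_complex_field p nrm"
    and "lam \<noteq> 0" and "nrm lam \<le> 1"
  shows "degenerate_Changhee_poly lam n x =
    (\<Sum>k=0..n. \<Sum>m=0..k. of_nat (n choose k) * degenerate_ffact lam m x
       * of_int (signed_stirling k m) * degenerate_Changhee_number lam (n - k))"
proof -
  let ?G = "degenerate_Changhee_gf lam 0"
  let ?c = "\<lambda>k. \<Sum>m=0..k. degenerate_ffact lam m x * of_int (signed_stirling k m)"
  have "degenerate_Changhee_poly lam n x = (\<Sum>k=0..n. fact n * (?c k / fact k * ?G $ (n - k)))"
    unfolding degenerate_Changhee_poly_def degenerate_Changhee_gf_eq[of lam x] fps_mult_nth
      degenerate_exp_compose_ln_nth sum_distrib_left ..
  \<comment> \<open>Since \<open>k \<le> n\<close>, \<open>fact n / fact k\<close> is the binomial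
    coefficient times \<open>fact (n - k)\<close>, which turns the coefficient of \<open>?G\<close>
    into a Changhee number.\<close>
  also have "\<dots> = (\<Sum>k=0..n. of_nat (n choose k) * ?c k * degenerate_Changhee_number lam (n - k))"
    by (intro sum.cong refl)
      (simp add: degenerate_Changhee_number_def degenerate_Changhee_poly_def binomial_fact)
  finally show ?thesis
    by (simp add: sum_distrib_left sum_distrib_right mult.assoc)
qed

end
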